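(* Let $F$ be a free filter on $\omega$. If $N_F$ has the bounded Josefson--Nissenzweig property (BJNP), then there exists an $\mathbb{F}_{\sigma\delta}$ P-filter $G$ on $\omega$ such that $F\subseteq G$ and $N_G$ has the BJNP, too.
   Context: A filter $F$ on $\omega$ is free if $\bigcap F=\emptyset$ (equivalently, $F$ contains every cofinite set); filters are proper. $G$ is a P-filter if for every sequence $\langle A_n\rangle$ in $G$ there is $A\in G$ with $A\setminus A_n$ finite for every $n$. Filters are viewed as subsets of the Cantor space $2^\omega$ via characteristic functions; "$\mathbb{F}_{\sigma\delta}$" refers to this. For a free filter $F$ on $\omega$, $N_F=\omega\cup\{p_F\}$, $p_F\notin\omega$, with the topology in which every point of $\omega$ is isolated and the open neighborhoods of $p_F$ are exactly the sets $A\cup\{p_F\}$ with $A\in F$. A finitely supported measure on a Tychonoff space $X$ is $\mu=\sum_{i=1}^n\alpha_i\delta_{x_i}$ with distinct $x_i\in X$ and $\alpha_i\in\mathbb{R}\setminus\{0\}$; $\|\mu\|=\sum_i|\alpha_i|$, $\mu(f)=\sum_i\alpha_i f(x_i)$. $X$ has the BJNP if there is a sequence $\langle\mu_n: n\in\omega\rangle$ of finitely supported measures on $X$ with $\|\mu_n\|=1$ for all $n$ and $\mu_n(f)\to0$ for every bounded continuous $f:X\to\mathbb{R}$. *)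

theory Defs
  imports "HOL-Analysis.Analysis" "HOL-Library.Poly_Mapping"
begin

section \<open>Filters on the natural numbers\<close>

text \<open>
  Filters are taken from the library type \<open>nat filter\<close>. That type also contains the improper
  filter \<open>bot\<close>, and its order is reverse inclusion of the underlying families of sets; the latter
  are therefore made explicit.
\<close>

definition filter_sets :: "'a filter \<Rightarrow> 'a set set" where
  "filter_sets F = {A. eventually (\<lambda>x. x \<in> A) F}"

definition free_filter :: "'a filter \<Rightarrow> bool" where
  "free_filter F \<longleftrightarrow> F \<noteq> bot \<and> \<Inter>(filter_sets F) = {}"

definition P_filter :: "'a filter \<Rightarrow> bool" where
  "P_filter G \<longleftrightarrow> G \<noteq> bot \<and>
     (\<forall>A :: nat \<Rightarrow> 'a set. (\<forall>n. A n \<in> filter_sets G) \<longrightarrow>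
        (\<exists>B \<in> filter_sets G. \<forall>n. finite (B - A n)))"

section \<open>Borel class in the Cantor space\<close>

definition cantor_space :: "(nat \<Rightarrow> bool) topology" where
  "cantor_space = product_topology (\<lambda>_. discrete_topology UNIV) UNIV"

definition char_fun :: "'a set \<Rightarrow> 'a \<Rightarrow> bool" where
  "char_fun A = (\<lambda>x. x \<in> A)"

definition fsigma_delta_in :: "'a topology \<Rightarrow> 'a set \<Rightarrow> bool" where
  "fsigma_delta_in X = (countable intersection_of fsigma_in X) relative_to topspace X"

section \<open>The space of a filter\<close>

text \<open>The isolated point \<open>n\<close> is \<open>Some n\<close>, and the extra point \<open>p\<^sub>F\<close> is \<open>None\<close>.\<close>

definition N_space :: "nat filter \<Rightarrow> nat option topology" where
  "N_space F = topology (\<lambda>U. None \<in> U \<longrightarrow> {n. Some n \<in> U} \<in> filter_sets F)"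

lemma openin_N_space:
  "openin (N_space F) U \<longleftrightarrow> (None \<in> U \<longrightarrow> {n. Some n \<in> U} \<in> filter_sets F)"
proof -
  have "istopology (\<lambda>U. None \<in> U \<longrightarrow> {n. Some n \<in> U} \<in> filter_sets F)"
    unfolding istopology_def filter_sets_def
  proof (intro conjI allI impI)
    fix S T :: "nat option set"
    assume "None \<in> S \<longrightarrow> {n. Some n \<in> S} \<in> {A. \<forall>\<^sub>F x in F. x \<in> A}"
      and "None \<in> T \<longrightarrow> {n. Some n \<in> T} \<in> {A. \<forall>\<^sub>F x in F. x \<in> A}" and "None \<in> S \<inter> T"
    then show "{n. Some n \<in> S \<inter> T} \<in> {A. \<forall>\<^sub>F x in F. x \<in> A}"
      by (simp add: eventually_conj_iff)
  next
    fix K :: "nat option set set"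
    assume *: "\<forall>U\<in>K. None \<in> U \<longrightarrow> {n. Some n \<in> U} \<in> {A. \<forall>\<^sub>F x in F. x \<in> A}"
      and "None \<in> \<Union>K"
    then obtain U where "U \<in> K" "\<forall>\<^sub>F n in F. Some n \<in> U"
      by auto
    then show "{n. Some n \<in> \<Union>K} \<in> {A. \<forall>\<^sub>F x in F. x \<in> A}"
      by (auto elim!: eventually_mono)
  qed
  then show ?thesis
    by (simp add: N_space_def)
qed

lemma topspace_N_space [simp]: "topspace (N_space F) = UNIV"
proof -
  have "openin (N_space F) UNIV"
    by (simp add: openin_N_space filter_sets_def)
  then show ?thesis
    using openin_subset by blast
qed

lemma openin_N_space_isolated: "openin (N_space F) {Some n}"
  by (simp add: openin_N_space)

lemma openin_N_space_None:
  "openin (N_space F) U \<and> None \<in> U \<longleftrightarrow> (\<exists>A \<in> filter_sets F. U = insert None (Some ` A))"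
proof
  assume "openin (N_space F) U \<and> None \<in> U"
  moreover from this have "U = insert None (Some ` {n. Some n \<in> U})"
    by (auto simp: image_iff) (metis option.exhaust)
  ultimately show "\<exists>A \<in> filter_sets F. U = insert None (Some ` A)"
    by (auto simp: openin_N_space)
next
  assume "\<exists>A \<in> filter_sets F. U = insert None (Some ` A)"
  then show "openin (N_space F) U \<and> None \<in> U"
    by (auto simp: openin_N_space image_iff)
qed

lemma free_filter_coatom:
  assumes "free_filter F"
  shows "- {x} \<in> filter_sets F"
proof -
  obtain A where "eventually (\<lambda>y. y \<in> A) F" "x \<notin> A"
    using assms unfolding free_filter_def filter_sets_def by blast
  then show ?thesis
    unfolding filter_sets_def by (auto elim!: eventually_mono)
qed

lemma openin_N_space_Compl_isolated:
  assumes "free_filter F"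
  shows "openin (N_space F) (- {Some n})"
proof -
  have "{m. Some m \<in> - {Some n}} = - {n}"
    by auto
  then show ?thesis
    using free_filter_coatom[OF assms, of n] by (simp add: openin_N_space)
qed

lemma Tychonoff_N_space:
  assumes F: "free_filter F"
  shows "completely_regular_space (N_space F)" and "Hausdorff_space (N_space F)"
proof -
  show "completely_regular_space (N_space F)"
    unfolding completely_regular_space_def
  proof (intro allI impI)
    fix S x
    assume "closedin (N_space F) S \<and> x \<in> topspace (N_space F) - S"
    then have op: "openin (N_space F) (- S)" and x: "x \<notin> S"
      by (auto simp: closedin_def Compl_eq_Diff_UNIV)
    obtain D where D: "openin (N_space F) D" "openin (N_space F) (- D)" "x \<in> D" "D \<inter> S = {}"
    proof (cases x)
      case None
      then show thesis
        using op x by (intro that[of "- S"]) (auto simp: openin_N_space)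
    next
      case (Some n)
      then show thesis
        using x openin_N_space_isolated openin_N_space_Compl_isolated[OF F]
        by (intro that[of "{x}"]) auto
    qed
    define g where "g = (\<lambda>y. if y \<in> D then 0 else 1 :: real)"
    have "openin (N_space F) {y. g y \<in> V}" for V
    proof -
      have "{y. g y \<in> V} \<in> {{}, UNIV, D, - D}"
        by (cases "1 \<in> V"; cases "0 \<in> V") (auto simp: g_def)
      then show ?thesis
        using D openin_topspace[of "N_space F"] by auto
    qed
    then have "continuous_map (N_space F) (top_of_set {0..1}) g"
      by (auto simp: continuous_map_def g_def)
    then show "\<exists>f. continuous_map (N_space F) (top_of_set {0..1::real}) f \<and> f x = 0 \<and> f ` S \<subseteq> {1}"
      using D by (intro exI[of _ g]) (auto simp: g_def)
  qed
  have sep: "\<exists>U V. openin (N_space F) U \<and> openin (N_space F) V \<and> Some n \<in> U \<and> y \<in> V \<and> disjnt U V"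
    if "y \<noteq> Some n" for n y
    using that openin_N_space_isolated openin_N_space_Compl_isolated[OF F, of n]
    by (intro exI[of _ "{Some n}"] exI[of _ "- {Some n}"]) (auto simp: disjnt_def)
  show "Hausdorff_space (N_space F)"
    unfolding Hausdorff_space_def
  proof (intro allI impI)
    fix x y
    assume "x \<in> topspace (N_space F) \<and> y \<in> topspace (N_space F) \<and> x \<noteq> y"
    then show "\<exists>U V. openin (N_space F) U \<and> openin (N_space F) V \<and> x \<in> U \<and> y \<in> V \<and> disjnt U V"
      using sep[of y] sep[of x] by (cases x; cases y) (auto simp: disjnt_sym; metis disjnt_sym)+
  qed
qed

section \<open>Finitely supported measures and the BJNP\<close>

text \<open>
  The measure \<open>\<Sum>i. \<alpha>\<^sub>i \<delta>\<^bsub>x\<^sub>i\<^esub>\<close> with distinct points \<open>x\<^sub>i\<close> and nonzero \<open>\<alpha>\<^sub>i\<close> is the finitely supported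
  function with \<open>x\<^sub>i \<mapsto> \<alpha>\<^sub>i\<close>; its \<open>keys\<close> are the points \<open>x\<^sub>i\<close>.
\<close>

definition fs_measure_on :: "'a topology \<Rightarrow> ('a \<Rightarrow>\<^sub>0 real) \<Rightarrow> bool" where
  "fs_measure_on X \<mu> \<longleftrightarrow> Poly_Mapping.keys \<mu> \<subseteq> topspace X"

definition fs_norm :: "('a \<Rightarrow>\<^sub>0 real) \<Rightarrow> real" where
  "fs_norm \<mu> = (\<Sum>x \<in> Poly_Mapping.keys \<mu>. \<bar>Poly_Mapping.lookup \<mu> x\<bar>)"

definition fs_integral :: "('a \<Rightarrow>\<^sub>0 real) \<Rightarrow> ('a \<Rightarrow> real) \<Rightarrow> real" where
  "fs_integral \<mu> f = (\<Sum>x \<in> Poly_Mapping.keys \<mu>. Poly_Mapping.lookup \<mu> x * f x)"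

text \<open>
  The property is meant for Tychonoff spaces only; \<open>N_space F\<close> is one for every free filter \<open>F\<close>
  (see \<open>Tychonoff_N_space\<close>).
\<close>

definition BJNP :: "'a topology \<Rightarrow> bool" where
  "BJNP X \<longleftrightarrow>
     (\<exists>\<mu> :: nat \<Rightarrow> ('a \<Rightarrow>\<^sub>0 real).
        (\<forall>n. fs_measure_on X (\<mu> n) \<and> fs_norm (\<mu> n) = 1) \<and>
        (\<forall>f. continuous_map X euclideanreal f \<and> bounded (f ` topspace X) \<longrightarrow>
             (\<lambda>n. fs_integral (\<mu> n) f) \<longlonglongrightarrow> 0))"

end

theory Submission
  imports Defs
begin

text \<open>
  Let \<open>\<mu>\<close> witness the BJNP of \<open>N_space F\<close>. Any bounded function vanishing at \<open>p\<^sub>F\<close> and on some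
  \<open>A \<in> F\<close> is continuous, so the restrictions of \<open>\<mu> n\<close> to the complement of \<open>A\<close> converge weakly to
  zero; by the Schur property of \<open>\<ell>\<^sub>1\<close> they converge in norm. Hence \<open>F\<close> is contained in the family
  \<open>G\<close> of all \<open>A\<close> with \<open>\<bar>\<mu> n\<bar>(\<omega> - A) \<longlonglongrightarrow> 0\<close>. This \<open>G\<close> is an \<open>F\<^sub>\<sigma>\<^sub>\<delta>\<close> P-filter, and the same
  sequence \<open>\<mu>\<close> witnesses the BJNP of \<open>N_space G\<close>. It is proper because testing \<open>\<mu> n\<close> against the
  constant function \<open>1\<close> forces asymptotically at least half of the total mass to lie on \<open>\<omega>\<close>.
\<close>

section \<open>Total variation of finitely supported measures\<close>

text \<open>The sum runs over the whole support with an indicator as weight, so that sums for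
  different sets share an index set and compare term by term.\<close>

definition variation :: "('a \<Rightarrow>\<^sub>0 real) \<Rightarrow> 'a set \<Rightarrow> real" where
  "variation \<mu> A =
     (\<Sum>x \<in> Poly_Mapping.keys \<mu>. \<bar>Poly_Mapping.lookup \<mu> x\<bar> * indicator A x)"

lemma variation_nonneg: "0 \<le> variation \<mu> A"
  unfolding variation_def by (intro sum_nonneg) auto

text \<open>Points outside the support carry no mass. The P-filter argument has its inclusion only
  within the support of one measure.\<close>

lemma variation_mono_on_keys:
  assumes "Poly_Mapping.keys \<mu> \<inter> A \<subseteq> B"
  shows "variation \<mu> A \<le> variation \<mu> B"
  unfolding variation_def
  using assms by (intro sum_mono mult_left_mono) (auto simp: indicator_def)

lemma variation_mono: "A \<subseteq> B \<Longrightarrow> variation \<mu> A \<le> variation \<mu> B"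
  by (rule variation_mono_on_keys) auto

lemma variation_Un_le: "variation \<mu> (A \<union> B) \<le> variation \<mu> A + variation \<mu> B"
  unfolding variation_def sum.distrib[symmetric]
  by (intro sum_mono) (auto simp: indicator_def)

lemma variation_empty [simp]: "variation \<mu> {} = 0"
  by (simp add: variation_def)

lemma tendsto_variation_mono:
  assumes "(\<lambda>n. variation (\<mu> n) B) \<longlonglongrightarrow> 0" "A \<subseteq> B"
  shows "(\<lambda>n. variation (\<mu> n) A) \<longlonglongrightarrow> 0"
  using assms(1)
  by (rule Lim_null_comparison[rotated])
     (simp add: variation_nonneg variation_mono[OF assms(2)])

lemma tendsto_variation_Un:
  assumes "(\<lambda>n. variation (\<mu> n) A) \<longlonglongrightarrow> 0" "(\<lambda>n. variation (\<mu> n) B) \<longlonglongrightarrow> 0"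
  shows "(\<lambda>n. variation (\<mu> n) (A \<union> B)) \<longlonglongrightarrow> 0"
  using tendsto_add_zero[OF assms]
  by (rule Lim_null_comparison[rotated]) (simp add: variation_nonneg variation_Un_le)

text \<open>At one point the variation is the modulus of the integral of the indicator, so weak
  convergence controls points and hence finite sets.\<close>

lemma tendsto_variation_singleton:
  assumes "(\<lambda>n. fs_integral (\<mu> n) (indicator {x})) \<longlonglongrightarrow> 0"
  shows "(\<lambda>n. variation (\<mu> n) {x}) \<longlonglongrightarrow> 0"
proof -
  have "variation (\<mu> n) {x} = \<bar>fs_integral (\<mu> n) (indicator {x})\<bar>" for n
  proof -
    have "variation (\<mu> n) {x} =
        (\<Sum>y \<in> Poly_Mapping.keys (\<mu> n). if y = x then \<bar>Poly_Mapping.lookup (\<mu> n) x\<bar> else 0)"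
      unfolding variation_def by (intro sum.cong) auto
    moreover have "fs_integral (\<mu> n) (indicator {x}) =
        (\<Sum>y \<in> Poly_Mapping.keys (\<mu> n). if y = x then Poly_Mapping.lookup (\<mu> n) x else 0)"
      unfolding fs_integral_def by (intro sum.cong) auto
    ultimately show ?thesis
      by simp
  qed
  then show ?thesis
    using tendsto_rabs_zero[OF assms] by simp
qed

lemma tendsto_variation_finite:
  assumes "finite E" "\<And>x. x \<in> E \<Longrightarrow> (\<lambda>n. variation (\<mu> n) {x}) \<longlonglongrightarrow> 0"
  shows "(\<lambda>n. variation (\<mu> n) E) \<longlonglongrightarrow> 0"
  using assms
proof (induction E)
  case (insert x E)
  then show ?case
    using tendsto_variation_Un[of \<mu> "{x}" E] by simp
qed simp

text \<open>Schur's theorem for finitely supported measures, by a gliding hump.\<close>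

lemma Schur_variation:
  fixes \<mu> :: "nat \<Rightarrow> ('a \<Rightarrow>\<^sub>0 real)"
  assumes weak: "\<And>f. (\<forall>x. \<bar>f x\<bar> \<le> 1) \<Longrightarrow> (\<forall>x. x \<notin> S \<longrightarrow> f x = 0) \<Longrightarrow>
                   (\<lambda>n. fs_integral (\<mu> n) f) \<longlonglongrightarrow> 0"
  shows "(\<lambda>n. variation (\<mu> n) S) \<longlonglongrightarrow> 0"
proof (rule ccontr)
  assume "\<not> ?thesis"
  then obtain e where e: "e > 0" and "\<not> (\<forall>\<^sub>F n in sequentially. variation (\<mu> n) S < e)"
    by (auto simp: tendsto_iff variation_nonneg)
  then have large: "\<exists>n\<ge>N. e \<le> variation (\<mu> n) S" for N
    by (auto simp: eventually_sequentially not_less)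
  \<comment> \<open>\<open>U n\<close> is finite and contains all supports up to index
    \<open>n\<close>, so later measures eventually have little mass on
    \<open>U n \<inter> S\<close>.\<close>
  define U where "U n = (\<Union>j\<le>n. Poly_Mapping.keys (\<mu> j))" for n
  have U_mono: "U m \<subseteq> U n" if "m \<le> n" for m n
    using that by (force simp: U_def)
  have small: "(\<lambda>n. variation (\<mu> n) (U k \<inter> S)) \<longlonglongrightarrow> 0" for k
  proof (rule tendsto_variation_finite)
    show "finite (U k \<inter> S)"
      by (simp add: U_def)
    show "(\<lambda>n. variation (\<mu> n) {x}) \<longlonglongrightarrow> 0" if "x \<in> U k \<inter> S" for x
      using that by (intro tendsto_variation_singleton weak) (auto simp: indicator_def)
  qed
  have step: "\<exists>n. e \<le> variation (\<mu> n) S \<and> (m < n \<and> variation (\<mu> n) (U m \<inter> S) < e / 4)" for m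
  proof -
    have "\<forall>\<^sub>F n in sequentially. variation (\<mu> n) (U m \<inter> S) < e / 4"
      using order_tendstoD(2)[OF small, of "e / 4"] e by simp
    then obtain N where "\<forall>n\<ge>N. variation (\<mu> n) (U m \<inter> S) < e / 4"
      by (auto simp: eventually_sequentially)
    then show ?thesis
      using large[of "max N (Suc m)"] by auto
  qed
  obtain r where r: "\<And>k. e \<le> variation (\<mu> (r k)) S"
      "\<And>k. r k < r (Suc k) \<and> variation (\<mu> (r (Suc k))) (U (r k) \<inter> S) < e / 4"
    using dependent_nat_choice[of "\<lambda>_ n. e \<le> variation (\<mu> n) S"
        "\<lambda>_ m n. m < n \<and> variation (\<mu> n) (U m \<inter> S) < e / 4"] large[of 0] step by metis
  have sm: "strict_mono r"
    using r(2) by (simp add: strict_mono_Suc_iff)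
  \<comment> \<open>At points of \<open>S\<close> first appearing at stage \<open>k\<close>,
    \<open>f\<close> copies the sign of \<open>\<mu> (r k)\<close>, so one function serves all
    humps. At points that never appear \<open>LEAST\<close> is unspecified, but \<open>sgn\<close>
    keeps the bound 1.\<close>
  define f where "f x = (if x \<in> S then
      sgn (Poly_Mapping.lookup (\<mu> (r (LEAST k. x \<in> U (r k)))) x) else 0)" for x
  have "(\<lambda>n. fs_integral (\<mu> n) f) \<longlonglongrightarrow> 0"
    by (rule weak) (auto simp: f_def sgn_if)
  then have "(\<lambda>k. fs_integral (\<mu> (r k)) f) \<longlonglongrightarrow> 0"
    using LIMSEQ_subseq_LIMSEQ[OF _ sm] by (force simp: o_def)
  then have "\<forall>\<^sub>F k in sequentially. fs_integral (\<mu> (r k)) f < e / 2"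
    using e by (intro order_tendstoD) auto
  \<comment> \<open>A successor index is taken because \<open>r(2)\<close> bounds the mass on old
    points only there.\<close>
  then obtain k where k: "fs_integral (\<mu> (r (Suc k))) f < e / 2"
    unfolding eventually_sequentially by (meson le_Suc_eq order_refl)
  define \<nu> where "\<nu> = \<mu> (r (Suc k))"
  \<comment> \<open>New points of \<open>S\<close> contribute their full mass, old ones at worst
    minus their mass; hence the factor 2. With at least \<open>e\<close> on \<open>S\<close> and
    less than \<open>e / 4\<close> on old points, the integral exceeds \<open>e / 2\<close>.\<close>
  have "variation \<nu> S - 2 * variation \<nu> (U (r k) \<inter> S) \<le> fs_integral \<nu> f"
    unfolding variation_def fs_integral_def sum_distrib_left sum_subtractf[symmetric]
  proof (rule sum_mono)
    fix x assume x: "x \<in> Poly_Mapping.keys \<nu>"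
    have bound: "- \<bar>Poly_Mapping.lookup \<nu> x\<bar> \<le> Poly_Mapping.lookup \<nu> x * f x"
      by (auto simp: f_def sgn_if)
    have new: "Poly_Mapping.lookup \<nu> x * f x = \<bar>Poly_Mapping.lookup \<nu> x\<bar>"
      if "x \<in> S" "x \<notin> U (r k)"
    proof -
      have "(LEAST k. x \<in> U (r k)) = Suc k"
      proof (rule Least_equality)
        show "x \<in> U (r (Suc k))"
          using x by (auto simp: U_def \<nu>_def)
        show "Suc k \<le> j" if "x \<in> U (r j)" for j
        proof (rule ccontr)
          assume "\<not> Suc k \<le> j"
          then have "r j \<le> r k"
            using sm by (simp add: strict_mono_less_eq)
          then show False
            using U_mono that \<open>x \<notin> U (r k)\<close> by blast
        qed
      qed
      then show ?thesis
        using that by (simp add: f_def \<nu>_def abs_sgn)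
    qed
    show "\<bar>Poly_Mapping.lookup \<nu> x\<bar> * indicator S x -
        2 * (\<bar>Poly_Mapping.lookup \<nu> x\<bar> * indicator (U (r k) \<inter> S) x)
      \<le> Poly_Mapping.lookup \<nu> x * f x"
    proof (cases "x \<in> S")
      case False
      then show ?thesis by (simp add: f_def)
    next
      case True
      then show ?thesis
        using bound new by (cases "x \<in> U (r k)") auto
    qed
  qed
  then show False
    using k r(1)[of "Suc k"] r(2)[of k] by (simp add: \<nu>_def)
qed

section \<open>The filter dual to the asymptotically null sets\<close>

definition variation_filter :: "(nat \<Rightarrow> ('a option \<Rightarrow>\<^sub>0 real)) \<Rightarrow> 'a filter" where
  "variation_filter \<mu> =
     Abs_filter (\<lambda>P. (\<lambda>n. variation (\<mu> n) (Some ` {x. \<not> P x})) \<longlonglongrightarrow> 0)"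

text \<open>Subadditivity and monotonicity of the variation give closure under conjunction and
  weakening, so \<open>Abs_filter\<close> is applied to a genuine filter, possibly
  \<open>bot\<close>.\<close>

lemma eventually_variation_filter:
  "eventually P (variation_filter \<mu>) \<longleftrightarrow>
     (\<lambda>n. variation (\<mu> n) (Some ` {x. \<not> P x})) \<longlonglongrightarrow> 0"
  unfolding variation_filter_def
proof (rule eventually_Abs_filter, unfold_locales)
  fix P Q :: "'a \<Rightarrow> bool"
  assume "(\<lambda>n. variation (\<mu> n) (Some ` {x. \<not> P x})) \<longlonglongrightarrow> 0"
    and "(\<lambda>n. variation (\<mu> n) (Some ` {x. \<not> Q x})) \<longlonglongrightarrow> 0"
  from tendsto_variation_Un[OF this]
  show "(\<lambda>n. variation (\<mu> n) (Some ` {x. \<not> (P x \<and> Q x)})) \<longlonglongrightarrow> 0"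
    by (rule tendsto_variation_mono) auto
next
  fix P Q :: "'a \<Rightarrow> bool"
  assume "\<forall>x. P x \<longrightarrow> Q x" and "(\<lambda>n. variation (\<mu> n) (Some ` {x. \<not> P x})) \<longlonglongrightarrow> 0"
  then show "(\<lambda>n. variation (\<mu> n) (Some ` {x. \<not> Q x})) \<longlonglongrightarrow> 0"
    by (elim tendsto_variation_mono) auto
qed simp

lemma filter_sets_variation_filter:
  "A \<in> filter_sets (variation_filter \<mu>) \<longleftrightarrow> (\<lambda>n. variation (\<mu> n) (Some ` (- A))) \<longlonglongrightarrow> 0"
  by (simp add: filter_sets_def eventually_variation_filter Compl_eq)

lemma variation_filter_neq_bot:
  fixes \<mu> :: "nat \<Rightarrow> ('a option \<Rightarrow>\<^sub>0 real)"
  assumes norm: "\<And>n. fs_norm (\<mu> n) = 1"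
    and const: "(\<lambda>n. fs_integral (\<mu> n) (\<lambda>_. 1)) \<longlonglongrightarrow> 0"
  shows "variation_filter \<mu> \<noteq> bot"
proof
  assume "variation_filter \<mu> = bot"
  then have "(\<lambda>n. variation (\<mu> n) (range Some)) \<longlonglongrightarrow> 0"
    using eventually_variation_filter[of "\<lambda>_. False" \<mu>] by simp
  from tendsto_add_zero[OF tendsto_rabs_zero[OF const] tendsto_mult_right_zero[OF this, of 2]]
  have lim: "(\<lambda>n. \<bar>fs_integral (\<mu> n) (\<lambda>_. 1)\<bar> + 2 * variation (\<mu> n) (range Some)) \<longlonglongrightarrow> 0" .
  have "1 \<le> \<bar>fs_integral (\<mu> n) (\<lambda>_. 1)\<bar> + 2 * variation (\<mu> n) (range Some)" for n
  proof -
    \<comment> \<open>This sign turns the term at \<open>None\<close> into its modulus; any other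
      term is at least minus its modulus, which the factor 2 compensates.\<close>
    define s where "s = sgn (Poly_Mapping.lookup (\<mu> n) None)"
    have s: "\<bar>s\<bar> \<le> 1"
      by (simp add: s_def sgn_if)
    have "fs_norm (\<mu> n) \<le> s * fs_integral (\<mu> n) (\<lambda>_. 1) + 2 * variation (\<mu> n) (range Some)"
      unfolding fs_norm_def fs_integral_def variation_def sum_distrib_left sum.distrib[symmetric]
    proof (rule sum_mono)
      fix x
      show "\<bar>Poly_Mapping.lookup (\<mu> n) x\<bar> \<le> s * (Poly_Mapping.lookup (\<mu> n) x * 1) +
          2 * (\<bar>Poly_Mapping.lookup (\<mu> n) x\<bar> * indicator (range Some) x)"
        by (cases x) (auto simp: s_def sgn_if)
    qed
    also have "s * fs_integral (\<mu> n) (\<lambda>_. 1) \<le> \<bar>fs_integral (\<mu> n) (\<lambda>_. 1)\<bar>"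
      using mult_right_mono[OF s, of "\<bar>fs_integral (\<mu> n) (\<lambda>_. 1)\<bar>"]
      by (simp flip: abs_mult)
    finally show ?thesis
      using norm by simp
  qed
  then have "(1::real) \<le> 0"
    by (intro LIMSEQ_le_const[OF lim]) auto
  then show False
    by simp
qed

text \<open>A diagonal argument: each complement \<open>- B n\<close> loses the finitely many points
  charged by measures before a threshold \<open>K n\<close>. The union of the remainders still has
  vanishing mass, and its complement is almost contained in every \<open>A n\<close>.\<close>

lemma P_filter_variation_filter:
  fixes \<mu> :: "nat \<Rightarrow> ('a option \<Rightarrow>\<^sub>0 real)"
  assumes "variation_filter \<mu> \<noteq> bot"
  shows "P_filter (variation_filter \<mu>)"
  unfolding P_filter_def
proof (intro conjI allI impI)
  fix A :: "nat \<Rightarrow> 'a set"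
  assume A: "\<forall>n. A n \<in> filter_sets (variation_filter \<mu>)"
  \<comment> \<open>Finite intersections make the complements increase, so the largest relevant one
    contains the others.\<close>
  define B where "B n = (\<Inter>j\<le>n. A j)" for n
  have B_anti: "B n \<subseteq> B m" if "m \<le> n" for m n
    using that by (force simp: B_def)
  have "B n \<in> filter_sets (variation_filter \<mu>)" for n
    using A by (simp add: B_def filter_sets_def eventually_ball_finite_distrib)
  then have "(\<lambda>k. variation (\<mu> k) (Some ` (- B n))) \<longlonglongrightarrow> 0" for n
    by (simp add: filter_sets_variation_filter)
  then have "\<forall>\<^sub>F k in sequentially. variation (\<mu> k) (Some ` (- B n)) < inverse (real (Suc n))"
    for n
    by (rule order_tendstoD) simp
  \<comment> \<open>Thresholds of at least \<open>n\<close> ensure that only finitely many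
    \<open>n\<close> satisfy \<open>K n \<le> k\<close>.\<close>
  then have "\<exists>N\<ge>n. \<forall>k\<ge>N. variation (\<mu> k) (Some ` (- B n)) < inverse (real (Suc n))" for n
    unfolding eventually_sequentially by (meson linorder_linear order_trans)
  then obtain K where K_ge: "\<And>n. n \<le> K n"
    and K: "\<And>n k. K n \<le> k \<Longrightarrow> variation (\<mu> k) (Some ` (- B n)) < inverse (real (Suc n))"
    by metis
  define D where "D n = (\<Union>k<K n. Some -` Poly_Mapping.keys (\<mu> k))" for n
  define C where "C = (\<Union>n. - B n - D n)"
  have C_lim: "(\<lambda>k. variation (\<mu> k) (Some ` C)) \<longlonglongrightarrow> 0"
    unfolding LIMSEQ_def
  proof (intro allI impI)
    fix e :: real assume "e > 0"
    then obtain N where N: "inverse (real (Suc N)) < e"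
      using reals_Archimedean by blast
    have "variation (\<mu> k) (Some ` C) < e" if k: "K N \<le> k" for k
    proof -
      \<comment> \<open>Only stages in \<open>I\<close> leave remainders that meet the support of
        \<open>\<mu> k\<close>. As \<open>N\<close> is among them, the maximum \<open>M\<close> is
        at least \<open>N\<close>, and \<open>- B M\<close> alone covers what \<open>\<mu> k\<close>
        sees of \<open>C\<close>.\<close>
      define I where "I = {n. K n \<le> k}"
      have I: "finite I"
        by (rule finite_subset[of _ "{..k}"]) (use K_ge order_trans in \<open>auto simp: I_def\<close>)
      define M where "M = Max I"
      have M: "K M \<le> k" "\<And>n. K n \<le> k \<Longrightarrow> n \<le> M"
        using Max_in[OF I] Max_ge[OF I] k unfolding M_def by (auto simp: I_def)
      have "Poly_Mapping.keys (\<mu> k) \<inter> Some ` C \<subseteq> Some ` (- B M)"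
      proof
        fix x assume x: "x \<in> Poly_Mapping.keys (\<mu> k) \<inter> Some ` C"
        then obtain i n where i: "x = Some i" "i \<notin> B n" "i \<notin> D n"
          by (auto simp: C_def)
        then have "K n \<le> k"
          using x by (auto simp: D_def not_less[symmetric])
        then show "x \<in> Some ` (- B M)"
          using i B_anti[OF M(2)] by blast
      qed
      then have "variation (\<mu> k) (Some ` C) \<le> variation (\<mu> k) (Some ` (- B M))"
        by (rule variation_mono_on_keys)
      also have "\<dots> < inverse (real (Suc M))"
        using K M by blast
      also have "\<dots> \<le> inverse (real (Suc N))"
        using M(2)[OF k] by (simp add: field_simps)
      finally show ?thesis
        using N by simp
    qed
    then show "\<exists>N. \<forall>k\<ge>N. dist (variation (\<mu> k) (Some ` C)) 0 < e"
      by (auto simp: variation_nonneg)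
  qed
  show "\<exists>B \<in> filter_sets (variation_filter \<mu>). \<forall>n. finite (B - A n)"
  proof (intro bexI allI)
    show "- C \<in> filter_sets (variation_filter \<mu>)"
      using C_lim by (simp add: filter_sets_variation_filter)
    fix n
    have "- C - A n \<subseteq> D n"
      by (auto simp: C_def B_def)
    moreover have "finite (D n)"
      by (auto simp: D_def intro!: finite_vimageI)
    ultimately show "finite (- C - A n)"
      by (rule finite_subset)
  qed
qed (rule assms)

section \<open>Borel complexity of the filter\<close>

lemma topspace_cantor_space [simp]: "topspace cantor_space = UNIV"
  by (simp add: cantor_space_def)

text \<open>The support is finite, so only finitely many coordinates of \<open>g\<close> matter; the
  term at \<open>None\<close> is constantly 0.\<close>

lemma continuous_map_variation_cantor:
  "continuous_map cantor_space euclideanreal (\<lambda>g. variation \<mu> (Some ` {i. \<not> g i}))"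
  unfolding variation_def
proof (intro continuous_map_sum continuous_map_real_mult continuous_map_canonical_const)
  fix x :: "nat option"
  show "continuous_map cantor_space euclideanreal (\<lambda>g. indicator (Some ` {i. \<not> g i}) x)"
  proof (cases x)
    case None
    then show ?thesis by simp
  next
    case (Some i)
    have "continuous_map cantor_space (discrete_topology UNIV) (\<lambda>g. g i)"
      unfolding cantor_space_def by (rule continuous_map_product_projection) simp
    then have "continuous_map cantor_space euclideanreal
        ((\<lambda>b. if b then 0 else 1) \<circ> (\<lambda>g. g i))"
      by (rule continuous_map_compose) simp
    moreover have "(\<lambda>g. indicator (Some ` {i. \<not> g i}) x) =
        ((\<lambda>b. if b then 0 else 1) \<circ> (\<lambda>g. g i) :: _ \<Rightarrow> real)"
      by (auto simp: Some indicator_def fun_eq_iff)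
    ultimately show ?thesis
      by simp
  qed
qed auto

text \<open>Convergence to 0 says: for all \<open>m\<close> there is \<open>K\<close> such that all
  \<open>n \<ge> K\<close> satisfy a non-strict, hence closed, bound. The three quantifiers become
  an intersection of unions of closed intersections.\<close>

lemma fsigma_delta_variation_filter:
  "fsigma_delta_in cantor_space (char_fun ` filter_sets (variation_filter \<mu>))"
proof -
  define L where "L m n =
    {g \<in> topspace cantor_space. variation (\<mu> n) (Some ` {i. \<not> g i}) \<in> {..inverse (real (Suc m))}}"
    for m n
  have L: "closedin cantor_space (L m n)" for m n
    unfolding L_def
    by (rule closedin_continuous_map_preimage[OF continuous_map_variation_cantor]) simp
  have "fsigma_in cantor_space (\<Union>K. \<Inter>n\<in>{K..}. L m n)" for m
  proof (rule fsigma_in_Union)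
    fix S assume "S \<in> range (\<lambda>K. \<Inter>n\<in>{K..}. L m n)"
    then show "fsigma_in cantor_space S"
      using L by (auto intro!: closed_imp_fsigma_in closedin_INT)
  qed simp
  then have "(countable intersection_of fsigma_in cantor_space) (\<Inter>m. \<Union>K. \<Inter>n\<in>{K..}. L m n)"
    by (auto simp: intersection_of_def intro!: exI[of _ "range (\<lambda>m. \<Union>K. \<Inter>n\<in>{K..}. L m n)"])
  moreover have "char_fun ` filter_sets (variation_filter \<mu>) = (\<Inter>m. \<Union>K. \<Inter>n\<in>{K..}. L m n)"
  proof -
    have "(\<lambda>n. variation (\<mu> n) S) \<longlonglongrightarrow> 0 \<longleftrightarrow>
        (\<forall>m. \<exists>K. \<forall>n\<in>{K..}. variation (\<mu> n) S \<le> inverse (real (Suc m)))" (is "?l \<longleftrightarrow> ?r") for S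
    proof
      assume ?l
      then have "\<forall>\<^sub>F n in sequentially. variation (\<mu> n) S < inverse (real (Suc m))" for m
        by (rule order_tendstoD) simp
      then show ?r
        unfolding eventually_sequentially by (meson atLeast_iff less_imp_le)
    next
      assume r: ?r
      show ?l
        unfolding LIMSEQ_def
      proof (intro allI impI)
        fix e :: real assume "e > 0"
        then obtain m where "inverse (real (Suc m)) < e"
          using reals_Archimedean by blast
        then show "\<exists>N. \<forall>n\<ge>N. dist (variation (\<mu> n) S) 0 < e"
          using r by (auto simp: variation_nonneg) (meson atLeast_iff le_less_trans)
      qed
    qed
    moreover have "char_fun ` filter_sets (variation_filter \<mu>) =
        {g. eventually g (variation_filter \<mu>)}"
    proof (intro equalityI subsetI)
      fix g assume "g \<in> {g. eventually g (variation_filter \<mu>)}"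
      then show "g \<in> char_fun ` filter_sets (variation_filter \<mu>)"
        by (intro image_eqI[of _ _ "Collect g"]) (auto simp: filter_sets_def char_fun_def)
    qed (auto simp: filter_sets_def char_fun_def)
    ultimately show ?thesis
      by (simp add: eventually_variation_filter L_def set_eq_iff)
  qed
  ultimately show ?thesis
    by (simp add: fsigma_delta_in_def)
qed

section \<open>Comparison with \<open>F\<close> and transfer of the BJNP\<close>

lemma filter_sets_subset_variation_filter:
  fixes \<mu> :: "nat \<Rightarrow> (nat option \<Rightarrow>\<^sub>0 real)"
  assumes lim: "\<And>f. continuous_map (N_space F) euclideanreal f \<Longrightarrow> bounded (range f) \<Longrightarrow>
                  (\<lambda>n. fs_integral (\<mu> n) f) \<longlonglongrightarrow> 0"
  shows "filter_sets F \<subseteq> filter_sets (variation_filter \<mu>)"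
proof
  fix A assume A: "A \<in> filter_sets F"
  have "(\<lambda>n. variation (\<mu> n) (Some ` (- A))) \<longlonglongrightarrow> 0"
  proof (rule Schur_variation)
    fix f :: "nat option \<Rightarrow> real"
    assume f: "\<forall>x. \<bar>f x\<bar> \<le> 1" "\<forall>x. x \<notin> Some ` (- A) \<longrightarrow> f x = 0"
    show "(\<lambda>n. fs_integral (\<mu> n) f) \<longlonglongrightarrow> 0"
    proof (rule lim)
      show "bounded (range f)"
        using f by (auto simp: bounded_iff)
      \<comment> \<open>This is continuity at \<open>None\<close>, the only point where it could
        fail: \<open>f\<close> vanishes on \<open>A\<close> as it does at
        \<open>None\<close>.\<close>
      have "{n. f (Some n) \<in> V} \<in> filter_sets F" if "f None \<in> V" for V
        using A unfolding filter_sets_def mem_Collect_eq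
      proof (rule eventually_mono)
        fix n assume "n \<in> A"
        then have "f (Some n) = f None"
          using f(2) by auto
        then show "f (Some n) \<in> V"
          using that by simp
      qed
      then show "continuous_map (N_space F) euclideanreal f"
        by (auto simp: continuous_map_def openin_N_space)
    qed
  qed
  then show "A \<in> filter_sets (variation_filter \<mu>)"
    by (simp add: filter_sets_variation_filter)
qed

text \<open>By \<open>const\<close>, subtracting the constant \<open>f None\<close> does not change
  the limit. The difference is small on a set of the filter and at most \<open>2 * M\<close> off it,
  where the mass tends to 0.\<close>

lemma tendsto_fs_integral_variation_filter:
  fixes \<mu> :: "nat \<Rightarrow> (nat option \<Rightarrow>\<^sub>0 real)"
  assumes norm: "\<And>n. fs_norm (\<mu> n) = 1"
    and const: "(\<lambda>n. fs_integral (\<mu> n) (\<lambda>_. 1)) \<longlonglongrightarrow> 0"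
    and f: "continuous_map (N_space (variation_filter \<mu>)) euclideanreal f" "bounded (range f)"
  shows "(\<lambda>n. fs_integral (\<mu> n) f) \<longlonglongrightarrow> 0"
proof -
  obtain M where M: "\<And>x. \<bar>f x\<bar> \<le> M"
    using f(2) by (auto simp: bounded_iff)
  have "(\<lambda>n. fs_integral (\<mu> n) f - f None * fs_integral (\<mu> n) (\<lambda>_. 1)) \<longlonglongrightarrow> 0"
    unfolding LIMSEQ_def
  proof (intro allI impI)
    fix e :: real assume e: "e > 0"
    define A where "A = {n. \<bar>f (Some n) - f None\<bar> < e / 2}"
    have "openin (N_space (variation_filter \<mu>)) {x. f x \<in> ball (f None) (e / 2)}"
      using openin_continuous_map_preimage[OF f(1), of "ball (f None) (e / 2)"]
      by (simp del: mem_ball)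
    then have "{n. f (Some n) \<in> ball (f None) (e / 2)} \<in> filter_sets (variation_filter \<mu>)"
      using e by (simp add: openin_N_space)
    also have "{n. f (Some n) \<in> ball (f None) (e / 2)} = A"
      by (auto simp: A_def dist_real_def abs_minus_commute)
    finally have "(\<lambda>n. 2 * M * variation (\<mu> n) (Some ` (- A))) \<longlonglongrightarrow> 0"
      unfolding filter_sets_variation_filter by (rule tendsto_mult_right_zero)
    then have "\<forall>\<^sub>F n in sequentially. 2 * M * variation (\<mu> n) (Some ` (- A)) < e / 2"
      using e by (intro order_tendstoD) auto
    moreover have "\<bar>fs_integral (\<mu> n) f - f None * fs_integral (\<mu> n) (\<lambda>_. 1)\<bar>
        \<le> e / 2 + 2 * M * variation (\<mu> n) (Some ` (- A))" for n
    proof -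
      have "fs_integral (\<mu> n) f - f None * fs_integral (\<mu> n) (\<lambda>_. 1) =
          (\<Sum>x \<in> Poly_Mapping.keys (\<mu> n). Poly_Mapping.lookup (\<mu> n) x * (f x - f None))"
        by (simp add: fs_integral_def sum_distrib_left sum_subtractf algebra_simps)
      also have "\<bar>\<dots>\<bar> \<le> (\<Sum>x \<in> Poly_Mapping.keys (\<mu> n).
          e / 2 * \<bar>Poly_Mapping.lookup (\<mu> n) x\<bar> +
          2 * M * (\<bar>Poly_Mapping.lookup (\<mu> n) x\<bar> * indicator (Some ` (- A)) x))"
      proof (rule order_trans[OF sum_abs], rule sum_mono)
        fix x
        \<comment> \<open>On \<open>A\<close> and at \<open>None\<close> the first summand suffices;
          elsewhere both values are at most \<open>M\<close> in modulus. Integrating,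
          \<open>e / 2\<close> meets total mass 1.\<close>
        have "\<bar>f x - f None\<bar> \<le> e / 2 + 2 * M * indicator (Some ` (- A)) x"
        proof (cases "x \<in> Some ` (- A)")
          case True
          then show ?thesis
            using M[of x] M[of None] e by simp
        next
          case False
          then show ?thesis
            using e by (cases x) (auto simp: A_def)
        qed
        then have "\<bar>Poly_Mapping.lookup (\<mu> n) x\<bar> * \<bar>f x - f None\<bar> \<le>
            \<bar>Poly_Mapping.lookup (\<mu> n) x\<bar> * (e / 2 + 2 * M * indicator (Some ` (- A)) x)"
          by (rule mult_left_mono) simp
        then show "\<bar>Poly_Mapping.lookup (\<mu> n) x * (f x - f None)\<bar> \<le>
          e / 2 * \<bar>Poly_Mapping.lookup (\<mu> n) x\<bar> +
          2 * M * (\<bar>Poly_Mapping.lookup (\<mu> n) x\<bar> * indicator (Some ` (- A)) x)"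
          by (simp add: abs_mult distrib_left mult_ac)
      qed
      also have "\<dots> = e / 2 * fs_norm (\<mu> n) + 2 * M * variation (\<mu> n) (Some ` (- A))"
        by (simp only: sum.distrib sum_distrib_left fs_norm_def variation_def)
      finally show ?thesis
        by (simp add: norm)
    qed
    ultimately show "\<exists>N. \<forall>n\<ge>N.
        dist (fs_integral (\<mu> n) f - f None * fs_integral (\<mu> n) (\<lambda>_. 1)) 0 < e"
      unfolding eventually_sequentially dist_real_def by (smt (verit) field_sum_of_halves)
  qed
  from tendsto_add_zero[OF this tendsto_mult_right_zero[OF const, of "f None"]]
  show ?thesis
    by simp
qed

theorem corollary6p5:
  fixes F :: "nat filter"
  assumes "free_filter F"
    and "BJNP (N_space F)"
  shows "\<exists>G :: nat filter.
           free_filter G \<and> P_filter G \<and>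
           fsigma_delta_in cantor_space (char_fun ` filter_sets G) \<and>
           filter_sets F \<subseteq> filter_sets G \<and>
           BJNP (N_space G)"
proof -
  obtain \<mu> :: "nat \<Rightarrow> (nat option \<Rightarrow>\<^sub>0 real)" where norm: "\<And>n. fs_norm (\<mu> n) = 1"
    and lim: "\<And>f. continuous_map (N_space F) euclideanreal f \<Longrightarrow> bounded (range f) \<Longrightarrow>
                (\<lambda>n. fs_integral (\<mu> n) f) \<longlonglongrightarrow> 0"
    using assms(2) by (auto simp: BJNP_def)
  have const: "(\<lambda>n. fs_integral (\<mu> n) (\<lambda>_. 1)) \<longlonglongrightarrow> 0"
    by (rule lim) auto
  have nb: "variation_filter \<mu> \<noteq> bot"
    using norm const by (rule variation_filter_neq_bot)
  have sub: "filter_sets F \<subseteq> filter_sets (variation_filter \<mu>)"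
    using lim by (rule filter_sets_subset_variation_filter)
  \<comment> \<open>A larger family of sets has a smaller intersection, so freeness passes upward
    from \<open>F\<close>.\<close>
  then have "free_filter (variation_filter \<mu>)"
    using assms(1) nb unfolding free_filter_def by blast
  moreover have "BJNP (N_space (variation_filter \<mu>))"
    unfolding BJNP_def using norm tendsto_fs_integral_variation_filter[OF norm const]
    by (intro exI[of _ \<mu>]) (auto simp: fs_measure_on_def)
  ultimately show ?thesis
    using P_filter_variation_filter[OF nb] fsigma_delta_variation_filter sub by blast
qed

end
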